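(* Let $p\ge1$. For every $t\ge0$ let $0<m_t\le L_t$, $\sigma_t\ge0$, $c_t\ge0$, $0\le\alpha_t\le\frac2{L_t}$, and let $f_t\in\mathcal S(m_t,L_t)$ with global minimizer $x_t^*\in\mathbb R^p$. Consider the iteration $x_{t+1}=x_t-\alpha_t(\nabla f_t(x_t)+v_t)$ with deterministic $x_0$, and assume $\|x_{t+1}^*-x_t^*\|\le\sigma_t$ for all $t$, and that $\{v_t\}$ is a zero-mean IID process with $\mathbb E\|v_t\|^2\le c_t^2$ for all $t$. Let $\mathcal T_t\subseteq\mathbb R_+^4\times\mathbb R^3$ be the set of tuples $(\rho_t,\lambda_t^{(1)},\ldots,\lambda_t^{(6)})$ with $\rho_t,\lambda_t^{(1)},\lambda_t^{(2)},\lambda_t^{(3)}\ge0$ and $\lambda_t^{(4)},\lambda_t^{(5)},\lambda_t^{(6)}\in\mathbb R$ satisfying $$\begin{bmatrix}1-\rho_t^2&-\alpha_t&1&-\alpha_t-\lambda_t^{(4)}\\-\alpha_t&\alpha_t^2&-\alpha_t&\alpha_t^2-\lambda_t^{(5)}\\1&-\alpha_t&1-\lambda_t^{(2)}&-\alpha_t-\lambda_t^{(6)}\\-\alpha_t-\lambda_t^{(4)}&\alpha_t^2-\lambda_t^{(5)}&-\alpha_t-\lambda_t^{(6)}&\alpha_t^2-\lambda_t^{(3)}\end{bmatrix}-\lambda_t^{(1)}\begin{bmatrix}Y_t&0_{2\times2}\\0_{2\times2}&0_{2\times2}\end{bmatrix}\preceq0.$$ Let $\hat U_0=\|x_0-x_0^*\|^2$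 and, for $t\ge0$, $$\hat U_{t+1}=\inf_{(\rho_t,\lambda_t^{(1)},\ldots,\lambda_t^{(6)})\in\mathcal T_t}\left(\rho_t^2\hat U_t+\lambda_t^{(2)}\sigma_t^2+\lambda_t^{(3)}c_t^2\right).$$ Then for all $t\ge0$, $$\hat U_{t+1}=\left(\mu_t\sqrt{\hat U_t}+\sigma_t\right)^2+\alpha_t^2c_t^2.$$
   Context: $\mathcal S(m,L)$ is the set of differentiable functions $f:\mathbb R^p\to\mathbb R$ having a unique global minimizer $x^*$ such that for all $x\in\mathbb R^p$ $$\begin{bmatrix}x-x^*\\ \nabla f(x)\end{bmatrix}^T\begin{bmatrix}-2mLI_p&(L+m)I_p\\(L+m)I_p&-2I_p\end{bmatrix}\begin{bmatrix}x-x^*\\ \nabla f(x)\end{bmatrix}\ge0.$$ $Y_t:=\begin{bmatrix}2L_tm_t&-(L_t+m_t)\\-(L_t+m_t)&2\end{bmatrix}$. $\mu_t:=1-m_t\alpha_t$ if $0\le\alpha_t\le\frac{2}{m_t+L_t}$, and $\mu_t:=\alpha_tL_t-1$ if $\frac{2}{m_t+L_t}\le\alpha_t\le\frac{2}{L_t}$. The functions $f_t$ are deterministic. $P\preceq0$ means the symmetric matrix $P$ is negative semidefinite; norms are Euclidean. *)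

theory Defs
  imports "HOL-Analysis.Analysis" "HOL-Probability.Probability"
begin

definition gradient :: "('a::real_inner \<Rightarrow> real) \<Rightarrow> 'a \<Rightarrow> 'a" where
  "gradient f x = (THE D. GDERIV f x :> D)"

definition block_vec :: "'a ^ 'm \<Rightarrow> 'a ^ 'n \<Rightarrow> 'a ^ ('m + 'n)" where
  "block_vec u w = (\<chi> i. case i of Inl a \<Rightarrow> u $ a | Inr b \<Rightarrow> w $ b)"

definition block_mat ::
  "'a ^ 'm ^ 'm \<Rightarrow> 'a ^ 'n ^ 'm \<Rightarrow> 'a ^ 'm ^ 'n \<Rightarrow> 'a ^ 'n ^ 'n
   \<Rightarrow> 'a ^ ('m + 'n) ^ ('m + 'n)" where
  "block_mat A B C D =
     (\<chi> i. case i of Inl a \<Rightarrow> block_vec (A $ a) (B $ a) | Inr b \<Rightarrow> block_vec (C $ b) (D $ b))"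

abbreviation is_global_min :: "('a \<Rightarrow> real) \<Rightarrow> 'a \<Rightarrow> bool" where
  "is_global_min f z \<equiv> is_arg_min f (\<lambda>_. True) z"

(* "mat k" is the scalar matrix k I. *)
definition fun_class :: "real \<Rightarrow> real \<Rightarrow> (real ^ 'p \<Rightarrow> real) set" where
  "fun_class m L =
     {f. (\<forall>x. f differentiable (at x)) \<and>
         (\<exists>!z. is_global_min f z) \<and>
         (\<forall>z. is_global_min f z \<longrightarrow>
            (\<forall>x. block_vec (x - z) (gradient f x) \<bullet>
                  (block_mat (mat (-2 * m * L)) (mat (L + m)) (mat (L + m)) (mat (-2))
                     *v block_vec (x - z) (gradient f x)) \<ge> 0))}"

definition neg_semidef :: "real ^ 'n ^ 'n \<Rightarrow> bool" where
  "neg_semidef A \<longleftrightarrow> transpose A = A \<and> (\<forall>w. w \<bullet> (A *v w) \<le> 0)"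

definition Y_mat :: "real \<Rightarrow> real \<Rightarrow> real ^ 2 ^ 2" where
  "Y_mat m L = vector [vector [2 * L * m, -(L + m)],
                       vector [-(L + m), 2]]"

definition pad_mat :: "real ^ 2 ^ 2 \<Rightarrow> real ^ 4 ^ 4" where
  "pad_mat Y = vector [vector [Y $ 1 $ 1, Y $ 1 $ 2, 0, 0],
                       vector [Y $ 2 $ 1, Y $ 2 $ 2, 0, 0],
                       vector [0, 0, 0, 0],
                       vector [0, 0, 0, 0]]"

definition lmi_mat ::
  "real \<Rightarrow> real \<Rightarrow> real \<Rightarrow> real \<Rightarrow> real \<Rightarrow> real \<Rightarrow> real \<Rightarrow> real ^ 4 ^ 4" where
  "lmi_mat \<alpha> \<rho> l2 l3 l4 l5 l6 =
     vector [vector [1 - \<rho>\<^sup>2, -\<alpha>, 1, -\<alpha> - l4],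
             vector [-\<alpha>, \<alpha>\<^sup>2, -\<alpha>, \<alpha>\<^sup>2 - l5],
             vector [1, -\<alpha>, 1 - l2, -\<alpha> - l6],
             vector [-\<alpha> - l4, \<alpha>\<^sup>2 - l5, -\<alpha> - l6, \<alpha>\<^sup>2 - l3]]"

definition feasible ::
  "real \<Rightarrow> real \<Rightarrow> real \<Rightarrow> (real \<times> real \<times> real \<times> real \<times> real \<times> real \<times> real) set" where
  "feasible m L \<alpha> =
     {(\<rho>, l1, l2, l3, l4, l5, l6).
        \<rho> \<ge> 0 \<and> l1 \<ge> 0 \<and> l2 \<ge> 0 \<and> l3 \<ge> 0 \<and>
        neg_semidef (lmi_mat \<alpha> \<rho> l2 l3 l4 l5 l6 - l1 *\<^sub>R pad_mat (Y_mat m L))}"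

(* Used only for 0 <= \<alpha> <= 2 / L; both formulas agree at \<alpha> = 2 / (m + L). *)
definition contraction :: "real \<Rightarrow> real \<Rightarrow> real \<Rightarrow> real" where
  "contraction m L \<alpha> = (if \<alpha> \<le> 2 / (m + L) then 1 - m * \<alpha> else \<alpha> * L - 1)"

definition zero_mean_iid :: "'w measure \<Rightarrow> (nat \<Rightarrow> 'w \<Rightarrow> real ^ 'p) \<Rightarrow> bool" where
  "zero_mean_iid M v \<longleftrightarrow>
     prob_space.indep_vars M (\<lambda>_. borel) v UNIV \<and>
     (\<forall>s t. distr M borel (v s) = distr M borel (v t)) \<and>
     (\<forall>t. integrable M (v t) \<and> integral\<^sup>L M (v t) = 0)"

end

theory Submission
  imports Defs
begin

text \<open>
  Restricted to a single step, the semidefinite constraint says that a quadratic form in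
  scalars $(e, g, d, w)$ is nonpositive. Evaluating it at $e = \sqrt{U}$, $d = \pm\sigma$, $w = 0$
  and $g = m e$ or $g = L e$, where the form of $Y$ vanishes, gives
  $(\mu\sqrt{U} + \sigma)^2 \le \rho^2 U + \lambda_2 \sigma^2$, and evaluating it at
  $(0, 0, 0, 1)$ gives $\alpha^2 \le \lambda_3$. Conversely, for every $\mu' > \mu$ some multiple
  of the form of $Y$ certifies $(e - \alpha g)^2 \le \mu'^2 e^2$, and the weighted
  AM-GM inequality $(a + d)^2 \le (1 + \tau) a^2 + (1 + 1/\tau) d^2$ with near-optimal $\tau$ yields
  feasible points whose values approach the lower bound. The infimum can fail to be attained, for
  instance when $m = L$ or when $U = 0$.
\<close>

section \<open>The matrix constraint as a scalar quadratic inequality\<close>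

lemma vector_4 [simp]:
  "(vector [x, y, z, w] :: 'a::zero ^ 4) $ 1 = x"
  "(vector [x, y, z, w] :: 'a::zero ^ 4) $ 2 = y"
  "(vector [x, y, z, w] :: 'a::zero ^ 4) $ 3 = z"
  "(vector [x, y, z, w] :: 'a::zero ^ 4) $ 4 = w"
  unfolding vector_def by simp_all

text \<open>Coordinates: \<open>e\<close> is the tracking error, \<open>g\<close> the gradient,
  \<open>d\<close> the shift of the minimizer and \<open>w\<close> the noise, so the left side is
  the squared error after one step. The form of \<open>Y_mat\<close> factors as
  \<open>2 * (g - m * e) * (g - L * e)\<close>; its zero lines \<open>g = m * e\<close> and
  \<open>g = L * e\<close> drive both bounds.\<close>

lemma neg_semidef_lmi_iff:
  "neg_semidef (lmi_mat \<alpha> \<rho> l2 l3 l4 l5 l6 - l1 *\<^sub>R pad_mat (Y_mat m L)) \<longleftrightarrow>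
   (\<forall>e g d w. (e - \<alpha> * g + d - \<alpha> * w)\<^sup>2
      \<le> \<rho>\<^sup>2 * e\<^sup>2 + l2 * d\<^sup>2 + l3 * w\<^sup>2 + 2 * l4 * e * w + 2 * l5 * g * w + 2 * l6 * d * w
         + 2 * l1 * (g - m * e) * (g - L * e))"
  (is "neg_semidef ?A \<longleftrightarrow> (\<forall>e g d w. ?l e g d w \<le> ?r e g d w)")
proof -
  have "transpose ?A = ?A"
    by (simp add: vec_eq_iff forall_4 transpose_def lmi_mat_def pad_mat_def Y_mat_def)
  moreover have form: "z \<bullet> (?A *v z) = ?l (z$1) (z$2) (z$3) (z$4) - ?r (z$1) (z$2) (z$3) (z$4)" for z
    by (simp add: inner_vec_def matrix_vector_mult_def sum_4 lmi_mat_def pad_mat_def Y_mat_def)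
       (simp add: algebra_simps power2_eq_square)
  moreover have "?l e g d w \<le> ?r e g d w" if "\<forall>z. z \<bullet> (?A *v z) \<le> 0" for e g d w
    using that[rule_format, of "vector [e, g, d, w]"] unfolding form by simp
  ultimately show ?thesis
    unfolding neg_semidef_def by (metis diff_le_0_iff_le)
qed

section \<open>Multipliers certifying the contraction factor\<close>

lemma contraction_nonneg:
  assumes "0 < m" "m \<le> L"
  shows "0 \<le> contraction m L \<alpha>"
proof (cases "\<alpha> \<le> 2 / (m + L)")
  case True
  have "m * \<alpha> \<le> m * (2 / (m + L))"
    using True assms by (intro mult_left_mono) auto
  also have "\<dots> \<le> 1"
    using assms by (simp add: field_simps)
  finally show ?thesis
    using True by (simp add: contraction_def)
next
  case False
  then have "2 / (m + L) * L \<le> \<alpha> * L"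
    using assms by (intro mult_right_mono) auto
  moreover have "1 \<le> 2 / (m + L) * L"
    using assms by (simp add: field_simps)
  ultimately show ?thesis
    using False by (simp add: contraction_def)
qed

lemma weighted_square_sum_le:
  fixes a b \<tau> :: real
  assumes "0 < \<tau>"
  shows "(a + b)\<^sup>2 \<le> (1 + \<tau>) * a\<^sup>2 + (1 + 1 / \<tau>) * b\<^sup>2"
proof -
  have "0 \<le> (\<tau> * a - b)\<^sup>2 / \<tau>"
    using assms by simp
  also have "\<dots> = (1 + \<tau>) * a\<^sup>2 + (1 + 1 / \<tau>) * b\<^sup>2 - (a + b)\<^sup>2"
    using assms by (simp add: field_simps power2_eq_square)
  finally show ?thesis by simp
qed

text \<open>An S-procedure in two variables. On a line \<open>g = k * e\<close> the left side is
  \<open>(1 - \<alpha> * k)\<^sup>2 * e\<^sup>2\<close>; for k between \<open>m\<close> and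
  \<open>L\<close> its coefficient is largest at an endpoint, and outside that interval the
  multiplier term is nonnegative and can compensate.\<close>

lemma contraction_certificate:
  assumes "m \<noteq> L" "0 < m" "m \<le> L" "0 \<le> \<alpha>"
  shows "\<exists>l\<ge>0. \<forall>e g. (e - \<alpha> * g)\<^sup>2
           \<le> (contraction m L \<alpha>)\<^sup>2 * e\<^sup>2 + 2 * l * (g - m * e) * (g - L * e)"
proof -
  \<comment> \<open>\<open>r\<close> is an endpoint where \<open>(1 - \<alpha> * k)\<^sup>2\<close>
    is largest, \<open>s\<close> the other one.\<close>
  define r where "r = (if \<alpha> \<le> 2 / (m + L) then m else L)"
  define s where "s = (if \<alpha> \<le> 2 / (m + L) then L else m)"
  \<comment> \<open>Both sides agree at \<open>g = r * e\<close>, so their difference must also be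
    stationary in \<open>g\<close> there; this forces
    \<open>l * (s - r) = \<alpha> * (1 - \<alpha> * r)\<close>, which is this value in both
    cases.\<close>
  define l where "l = \<alpha> * contraction m L \<alpha> / (L - m)"
  have pos: "0 < L - m" using assms by simp
  have "0 \<le> l"
    unfolding l_def using contraction_nonneg[of m L \<alpha>] assms pos by simp
  have mul: "l * (L - m) = \<alpha> * contraction m L \<alpha>"
    unfolding l_def using pos by simp
  have c2: "(contraction m L \<alpha>)\<^sup>2 = (1 - \<alpha> * r)\<^sup>2"
    by (simp add: contraction_def r_def power2_eq_square algebra_simps)
  have ls: "l * (s - r) = \<alpha> * (1 - \<alpha> * r)"
    using mul by (simp add: contraction_def r_def s_def algebra_simps split: if_splits)
  have prod: "(g - m * e) * (g - L * e) = (g - r * e) * (g - s * e)" for g e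
    by (simp add: r_def s_def)
  \<comment> \<open>In each branch this is a rearrangement of the branch condition comparing
    \<alpha> with \<open>2 / (m + L)\<close>.\<close>
  have "\<alpha> * (L - m) \<le> 2 * contraction m L \<alpha>"
    using assms by (auto simp: contraction_def field_simps)
  then have "\<alpha> * (\<alpha> * (L - m)) \<le> \<alpha> * (2 * contraction m L \<alpha>)"
    using assms by (intro mult_left_mono) auto
  then have "\<alpha>\<^sup>2 * (L - m) \<le> 2 * l * (L - m)"
    using mul by (simp add: power2_eq_square mult.assoc mult.left_commute)
  then have l: "\<alpha>\<^sup>2 \<le> 2 * l"
    using pos by simp
  have "(e - \<alpha> * g)\<^sup>2
          \<le> (contraction m L \<alpha>)\<^sup>2 * e\<^sup>2 + 2 * l * (g - m * e) * (g - L * e)" for e g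
  proof -
    \<comment> \<open>The multiplier \<open>l\<close> is chosen so that the gap is a perfect square.\<close>
    have "(contraction m L \<alpha>)\<^sup>2 * e\<^sup>2 + 2 * l * (g - m * e) * (g - L * e) - (e - \<alpha> * g)\<^sup>2
        = (2 * l - \<alpha>\<^sup>2) * (g - r * e)\<^sup>2
          - 2 * (l * (s - r) - \<alpha> * (1 - \<alpha> * r)) * e * (g - r * e)"
      unfolding c2 mult.assoc[of _ "g - m * e"] prod by (simp add: algebra_simps power2_eq_square)
    also have "\<dots> \<ge> 0"
      using l ls by simp
    finally show ?thesis by simp
  qed
  with \<open>0 \<le> l\<close> show ?thesis by blast
qed

text \<open>For \<open>m = L\<close> the product is a square and cannot cancel the cross term
  between \<open>e\<close> and \<open>g - m * e\<close>, so the exact factor has no multiplier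
  unless \<open>\<alpha> * (1 - \<alpha> * m) = 0\<close>. Any slack in the factor lets a large
  multiplier absorb that term.\<close>

lemma approximate_contraction_certificate:
  assumes "0 < m" "m \<le> L" "0 \<le> \<alpha>" "contraction m L \<alpha> < \<mu>"
  shows "\<exists>l\<ge>0. \<forall>e g. (e - \<alpha> * g)\<^sup>2 \<le> \<mu>\<^sup>2 * e\<^sup>2 + 2 * l * (g - m * e) * (g - L * e)"
proof (cases "m = L")
  case False
  then obtain l where l: "0 \<le> l" "\<And>e g. (e - \<alpha> * g)\<^sup>2
           \<le> (contraction m L \<alpha>)\<^sup>2 * e\<^sup>2 + 2 * l * (g - m * e) * (g - L * e)"
    using contraction_certificate assms by blast
  have "(contraction m L \<alpha>)\<^sup>2 \<le> \<mu>\<^sup>2"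
    using assms contraction_nonneg[of m L \<alpha>] by (intro power_mono) auto
  then have "(contraction m L \<alpha>)\<^sup>2 * e\<^sup>2 \<le> \<mu>\<^sup>2 * e\<^sup>2" for e
    by (intro mult_right_mono) auto
  then show ?thesis
    using l by (smt (verit))
next
  case True
  define \<kappa> where "\<kappa> = contraction m L \<alpha>"
  have \<kappa>: "0 \<le> \<kappa>" "\<kappa> < \<mu>" "\<kappa>\<^sup>2 = (1 - \<alpha> * m)\<^sup>2"
    using assms contraction_nonneg[of m L \<alpha>] True
    by (auto simp: \<kappa>_def contraction_def power2_eq_square algebra_simps)
  have "\<kappa>\<^sup>2 < \<mu>\<^sup>2"
    using \<kappa> by (intro power_strict_mono) auto
  \<comment> \<open>Small enough for
    \<open>(1 + \<tau>) * \<kappa>\<^sup>2 \<le> \<mu>\<^sup>2\<close>; the 1 in the denominator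
    keeps \<tau> positive when \<kappa> is 0.\<close>
  define \<tau> where "\<tau> = (\<mu>\<^sup>2 - \<kappa>\<^sup>2) / (1 + \<kappa>\<^sup>2)"
  have den: "0 < 1 + \<kappa>\<^sup>2"
    by (simp add: add_pos_nonneg)
  then have \<tau>: "0 < \<tau>"
    using \<open>\<kappa>\<^sup>2 < \<mu>\<^sup>2\<close> by (simp add: \<tau>_def)
  have "\<tau> * (1 + \<kappa>\<^sup>2) = \<mu>\<^sup>2 - \<kappa>\<^sup>2"
    using den by (simp add: \<tau>_def)
  then have \<tau>\<kappa>: "(1 + \<tau>) * \<kappa>\<^sup>2 \<le> \<mu>\<^sup>2"
    using \<tau> by (simp add: algebra_simps)
  define l where "l = (1 + 1 / \<tau>) * \<alpha>\<^sup>2 / 2"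
  have "(e - \<alpha> * g)\<^sup>2 \<le> \<mu>\<^sup>2 * e\<^sup>2 + 2 * l * (g - m * e) * (g - L * e)" for e g
  proof -
    have "(e - \<alpha> * g)\<^sup>2 = ((1 - \<alpha> * m) * e + (- \<alpha>) * (g - m * e))\<^sup>2"
      by (simp add: algebra_simps)
    also have "\<dots> \<le> (1 + \<tau>) * ((1 - \<alpha> * m) * e)\<^sup>2 + (1 + 1 / \<tau>) * ((- \<alpha>) * (g - m * e))\<^sup>2"
      by (rule weighted_square_sum_le[OF \<tau>])
    also have "\<dots> = (1 + \<tau>) * \<kappa>\<^sup>2 * e\<^sup>2 + 2 * l * (g - m * e) * (g - L * e)"
      using True by (simp add: \<kappa>(3) l_def power_mult_distrib) (simp add: power2_eq_square)
    also have "\<dots> \<le> \<mu>\<^sup>2 * e\<^sup>2 + 2 * l * (g - m * e) * (g - L * e)"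
      using \<tau>\<kappa> by (intro add_right_mono mult_right_mono) auto
    finally show ?thesis .
  qed
  moreover have "0 \<le> l"
    using \<tau> by (simp add: l_def)
  ultimately show ?thesis by blast
qed

section \<open>Lower bound and near-optimal feasible points\<close>

lemma feasible_value_ge:
  assumes "(\<rho>, l1, l2, l3, l4, l5, l6) \<in> feasible m L \<alpha>"
  shows "(contraction m L \<alpha> * u + \<sigma>)\<^sup>2 + \<alpha>\<^sup>2 * c\<^sup>2 \<le> \<rho>\<^sup>2 * u\<^sup>2 + l2 * \<sigma>\<^sup>2 + l3 * c\<^sup>2"
proof -
  have form: "(e - \<alpha> * g + d - \<alpha> * w)\<^sup>2
      \<le> \<rho>\<^sup>2 * e\<^sup>2 + l2 * d\<^sup>2 + l3 * w\<^sup>2 + 2 * l4 * e * w + 2 * l5 * g * w + 2 * l6 * d * w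
         + 2 * l1 * (g - m * e) * (g - L * e)" for e g d w
    using assms unfolding feasible_def neg_semidef_lmi_iff by blast
  have "\<alpha>\<^sup>2 \<le> l3"
    using form[of 0 0 0 1] by simp
  then have "\<alpha>\<^sup>2 * c\<^sup>2 \<le> l3 * c\<^sup>2"
    by (intro mult_right_mono) auto
  moreover have "(contraction m L \<alpha> * u + \<sigma>)\<^sup>2 \<le> \<rho>\<^sup>2 * u\<^sup>2 + l2 * \<sigma>\<^sup>2"
  proof (cases "\<alpha> \<le> 2 / (m + L)")
    case True
    then have "contraction m L \<alpha> * u + \<sigma> = u - \<alpha> * (m * u) + \<sigma> - \<alpha> * 0"
      by (simp add: contraction_def algebra_simps)
    then show ?thesis
      using form[of u "m * u" \<sigma> 0] by simp
  next
    case False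
    \<comment> \<open>Here \<open>1 - \<alpha> * L\<close> is minus the contraction factor, so the
      drift is taken with the opposite sign to make the two contributions add up.\<close>
    then have "contraction m L \<alpha> * u + \<sigma> = - (u - \<alpha> * (L * u) + (- \<sigma>) - \<alpha> * 0)"
      by (simp add: contraction_def algebra_simps)
    then have "(contraction m L \<alpha> * u + \<sigma>)\<^sup>2 = (u - \<alpha> * (L * u) + (- \<sigma>) - \<alpha> * 0)\<^sup>2"
      by (simp only: power2_minus)
    then show ?thesis
      using form[of u "L * u" "- \<sigma>" 0] by simp
  qed
  ultimately show ?thesis by simp
qed

text \<open>The last four entries reproduce every term containing \<open>w\<close> exactly, which
  leaves an inequality in \<open>e\<close>, \<open>g\<close>, \<open>d\<close>. Separating
  \<open>d\<close> with weight \<tau> costs a factor \<open>1 + \<tau>\<close> on the contraction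
  certificate, hence the square root in the first entry.\<close>

lemma feasible_approx:
  assumes "0 < m" "m \<le> L" "0 \<le> \<alpha>" "contraction m L \<alpha> < \<mu>" "0 < \<tau>"
  obtains l1 where "(\<mu> * sqrt (1 + \<tau>), l1, 1 + 1 / \<tau>, \<alpha>\<^sup>2, - \<alpha>, \<alpha>\<^sup>2, - \<alpha>) \<in> feasible m L \<alpha>"
proof -
  obtain l where l: "0 \<le> l"
    "\<And>e g. (e - \<alpha> * g)\<^sup>2 \<le> \<mu>\<^sup>2 * e\<^sup>2 + 2 * l * (g - m * e) * (g - L * e)"
    using approximate_contraction_certificate[OF assms(1-4)] by blast
  have "(e - \<alpha> * g + d - \<alpha> * w)\<^sup>2
      \<le> (\<mu> * sqrt (1 + \<tau>))\<^sup>2 * e\<^sup>2 + (1 + 1 / \<tau>) * d\<^sup>2 + \<alpha>\<^sup>2 * w\<^sup>2 + 2 * (- \<alpha>) * e * w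
         + 2 * \<alpha>\<^sup>2 * g * w + 2 * (- \<alpha>) * d * w
         + 2 * ((1 + \<tau>) * l) * (g - m * e) * (g - L * e)" for e g d w
  proof -
    have "(e - \<alpha> * g + d)\<^sup>2 \<le> (1 + \<tau>) * (e - \<alpha> * g)\<^sup>2 + (1 + 1 / \<tau>) * d\<^sup>2"
      by (rule weighted_square_sum_le[OF assms(5)])
    also have "\<dots> \<le> (1 + \<tau>) * (\<mu>\<^sup>2 * e\<^sup>2 + 2 * l * (g - m * e) * (g - L * e))
                     + (1 + 1 / \<tau>) * d\<^sup>2"
      using l(2) assms(5) by (intro add_right_mono mult_left_mono) auto
    also have "(1 + \<tau>) * (\<mu>\<^sup>2 * e\<^sup>2 + 2 * l * (g - m * e) * (g - L * e))
        = (\<mu> * sqrt (1 + \<tau>))\<^sup>2 * e\<^sup>2 + 2 * ((1 + \<tau>) * l) * (g - m * e) * (g - L * e)"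
      using assms(5) by (simp add: power_mult_distrib) (simp add: algebra_simps)
    finally show ?thesis
      by (simp add: power2_eq_square algebra_simps)
  qed
  moreover have "0 \<le> \<mu>"
    using contraction_nonneg[OF assms(1,2)] assms(4) by (meson le_less_trans less_imp_le)
  ultimately have "(\<mu> * sqrt (1 + \<tau>), (1 + \<tau>) * l, 1 + 1 / \<tau>, \<alpha>\<^sup>2, - \<alpha>, \<alpha>\<^sup>2, - \<alpha>) \<in> feasible m L \<alpha>"
    unfolding feasible_def neg_semidef_lmi_iff using l(1) assms(5) by simp
  then show thesis by (rule that)
qed

text \<open>Enlarging the factor, \<open>u\<close> and \<sigma> by \<epsilon> provides the slack for
  the certificate and keeps both summands positive, so that their ratio is a valid weight even if
  some of these quantities vanish.\<close>

lemma feasible_value_le: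
  assumes "0 < m" "m \<le> L" "0 \<le> \<alpha>" "0 \<le> u" "0 \<le> \<sigma>" "0 < \<epsilon>"
  obtains \<rho> l1 l2 l3 l4 l5 l6 where "(\<rho>, l1, l2, l3, l4, l5, l6) \<in> feasible m L \<alpha>"
    "\<rho>\<^sup>2 * u\<^sup>2 + l2 * \<sigma>\<^sup>2 + l3 * c\<^sup>2
       \<le> ((contraction m L \<alpha> + \<epsilon>) * (u + \<epsilon>) + (\<sigma> + \<epsilon>))\<^sup>2 + \<alpha>\<^sup>2 * c\<^sup>2"
proof -
  define \<mu> where "\<mu> = contraction m L \<alpha> + \<epsilon>"
  define a where "a = \<mu> * (u + \<epsilon>)"
  define b where "b = \<sigma> + \<epsilon>"
  have \<mu>: "0 < \<mu>"
    using contraction_nonneg[of m L \<alpha>] assms by (simp add: \<mu>_def)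
  then have pos: "0 < a" "0 < b"
    using assms by (simp_all add: a_def b_def)
  \<comment> \<open>The weight that turns the weighted bound for \<open>(a + b)\<^sup>2\<close> into
    an equality.\<close>
  define \<tau> where "\<tau> = b / a"
  have \<tau>: "0 < \<tau>" using pos by (simp add: \<tau>_def)
  obtain l1 where feas:
    "(\<mu> * sqrt (1 + \<tau>), l1, 1 + 1 / \<tau>, \<alpha>\<^sup>2, - \<alpha>, \<alpha>\<^sup>2, - \<alpha>) \<in> feasible m L \<alpha>"
    using feasible_approx[OF assms(1-3) _ \<tau>, of \<mu>] assms(6) by (auto simp: \<mu>_def)
  have "(\<mu> * sqrt (1 + \<tau>))\<^sup>2 * u\<^sup>2 = (1 + \<tau>) * (\<mu> * u)\<^sup>2"
    using \<tau> by (simp add: power_mult_distrib)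
  also have "\<dots> \<le> (1 + \<tau>) * a\<^sup>2"
    using \<tau> \<mu> assms by (intro mult_left_mono power_mono) (auto simp: a_def)
  finally have "(\<mu> * sqrt (1 + \<tau>))\<^sup>2 * u\<^sup>2 \<le> (1 + \<tau>) * a\<^sup>2" .
  moreover have "(1 + 1 / \<tau>) * \<sigma>\<^sup>2 \<le> (1 + 1 / \<tau>) * b\<^sup>2"
    using \<tau> assms by (intro mult_left_mono power_mono) (auto simp: b_def)
  moreover have "(1 + \<tau>) * a\<^sup>2 + (1 + 1 / \<tau>) * b\<^sup>2 = (a + b)\<^sup>2"
    using pos by (simp add: \<tau>_def field_simps power2_eq_square)
  ultimately have "(\<mu> * sqrt (1 + \<tau>))\<^sup>2 * u\<^sup>2 + (1 + 1 / \<tau>) * \<sigma>\<^sup>2 + \<alpha>\<^sup>2 * c\<^sup>2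
      \<le> (a + b)\<^sup>2 + \<alpha>\<^sup>2 * c\<^sup>2"
    by simp
  with feas show thesis
    by (intro that) (auto simp: a_def b_def \<mu>_def)
qed

section \<open>Value of the infimum and the recursion\<close>

lemma INF_feasible_value:
  assumes "0 < m" "m \<le> L" "0 \<le> \<alpha>" "0 \<le> u" "0 \<le> \<sigma>"
  shows "(INF (\<rho>, l1, l2, l3, l4, l5, l6) \<in> feasible m L \<alpha>.
            \<rho>\<^sup>2 * u\<^sup>2 + l2 * \<sigma>\<^sup>2 + l3 * c\<^sup>2)
         = (contraction m L \<alpha> * u + \<sigma>)\<^sup>2 + \<alpha>\<^sup>2 * c\<^sup>2"
  (is "(INF p \<in> ?F. ?val p) = ?opt")
proof (rule antisym)
  have lower: "?opt \<le> ?val p" if "p \<in> ?F" for p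
    using that by (auto split: prod.split simp: feasible_value_ge)
  have bdd: "bdd_below (?val ` ?F)"
    using lower by (rule bdd_belowI2)
  have "?F \<noteq> {}"
    using feasible_value_le[OF assms zero_less_one] by blast
  then show "?opt \<le> (INF p \<in> ?F. ?val p)"
    using lower by (rule cINF_greatest)
  \<comment> \<open>Feasible points are available only for positive \<epsilon>, so the upper bound
    is passed to the limit from the right.\<close>
  let ?B = "\<lambda>\<epsilon>. ((contraction m L \<alpha> + \<epsilon>) * (u + \<epsilon>) + (\<sigma> + \<epsilon>))\<^sup>2 + \<alpha>\<^sup>2 * c\<^sup>2"
  have "(?B \<longlongrightarrow> ?B 0) (at_right 0)"
    by (intro tendsto_intros)
  then have lim: "(?B \<longlongrightarrow> ?opt) (at_right 0)"
    by simp
  have upper: "(INF p \<in> ?F. ?val p) \<le> ?B \<epsilon>" if \<epsilon>: "0 < \<epsilon>" for \<epsilon>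
  proof -
    obtain \<rho> l1 l2 l3 l4 l5 l6 where p: "(\<rho>, l1, l2, l3, l4, l5, l6) \<in> ?F"
      "\<rho>\<^sup>2 * u\<^sup>2 + l2 * \<sigma>\<^sup>2 + l3 * c\<^sup>2 \<le> ?B \<epsilon>"
      by (rule feasible_value_le[OF assms \<epsilon>])
    from cINF_lower[OF bdd p(1)] p(2) show ?thesis by simp
  qed
  have "\<forall>\<^sub>F \<epsilon> in at_right 0. (INF p \<in> ?F. ?val p) \<le> ?B \<epsilon>"
    using eventually_at_right_less by eventually_elim (rule upper)
  then show "(INF p \<in> ?F. ?val p) \<le> ?opt"
    by (rule tendsto_lowerbound[OF lim]) simp
qed

theorem theorem4p2:
  fixes m L \<sigma> c \<alpha> U :: "nat \<Rightarrow> real"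
    and f :: "nat \<Rightarrow> real ^ 'p \<Rightarrow> real"
    and xs :: "nat \<Rightarrow> real ^ 'p"
    and M :: "'w measure"
    and x v :: "nat \<Rightarrow> 'w \<Rightarrow> real ^ 'p"
    and x0 :: "real ^ 'p"
  assumes "prob_space M"
    and "\<And>t. 0 < m t" and "\<And>t. m t \<le> L t"
    and "\<And>t. 0 \<le> \<sigma> t" and "\<And>t. 0 \<le> c t"
    and "\<And>t. 0 \<le> \<alpha> t" and "\<And>t. \<alpha> t \<le> 2 / L t"
    and "\<And>t. f t \<in> fun_class (m t) (L t)"
    and "\<And>t. is_global_min (f t) (xs t)"
    and "\<And>\<omega>. \<omega> \<in> space M \<Longrightarrow> x 0 \<omega> = x0"
    and "\<And>t \<omega>. \<omega> \<in> space M \<Longrightarrow>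
           x (Suc t) \<omega> = x t \<omega> - \<alpha> t *\<^sub>R (gradient (f t) (x t \<omega>) + v t \<omega>)"
    and "\<And>t. norm (xs (Suc t) - xs t) \<le> \<sigma> t"
    and "zero_mean_iid M v"
    and "\<And>t. integrable M (\<lambda>\<omega>. (norm (v t \<omega>))\<^sup>2)"
    and "\<And>t. (\<integral>\<omega>. (norm (v t \<omega>))\<^sup>2 \<partial>M) \<le> (c t)\<^sup>2"
    and "U 0 = (norm (x0 - xs 0))\<^sup>2"
    and "\<And>t. U (Suc t) =
           (INF (\<rho>, l1, l2, l3, l4, l5, l6) \<in> feasible (m t) (L t) (\<alpha> t).
              \<rho>\<^sup>2 * U t + l2 * (\<sigma> t)\<^sup>2 + l3 * (c t)\<^sup>2)"
  shows "\<forall>t. U (Suc t) =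
           (contraction (m t) (L t) (\<alpha> t) * sqrt (U t) + \<sigma> t)\<^sup>2 + (\<alpha> t)\<^sup>2 * (c t)\<^sup>2"
proof -
  note par = \<open>\<And>t. 0 < m t\<close> \<open>\<And>t. m t \<le> L t\<close> \<open>\<And>t. 0 \<le> \<alpha> t\<close>
  have step: "U (Suc t) =
      (contraction (m t) (L t) (\<alpha> t) * sqrt (U t) + \<sigma> t)\<^sup>2 + (\<alpha> t)\<^sup>2 * (c t)\<^sup>2"
    if "0 \<le> U t" for t
    using INF_feasible_value[OF par real_sqrt_ge_zero[OF that] \<open>\<And>t. 0 \<le> \<sigma> t\<close>, where c = "c t"]
      that assms(17)[of t] by simp
  \<comment> \<open>Nonnegativity makes \<open>(sqrt (U t))\<^sup>2\<close> equal to
    \<open>U t\<close>; it propagates because \<open>step\<close> writes the next value as a sum of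
    squares.\<close>
  have "0 \<le> U t" for t
    by (induction t) (simp_all add: step \<open>U 0 = _\<close>)
  with step show ?thesis by blast
qed

end
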